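(* Let $\mathcal M\subset\mathbb R^d$ be a smooth compact submanifold with reach $\tau$, let $V=\{(\mathbf m,\mathbf v)\in N\mathcal M:\|\mathbf v\|_2<\tau\}$, let $E(\mathbf m,\mathbf v)=\mathbf m+\mathbf v$, and let $U=E(V)$ be the tubular neighborhood of $\mathcal M$. Let $\pi\colon N\mathcal M\to\mathcal M$, $(\mathbf m,\mathbf n)\mapsto\mathbf m$, be the canonical projection. Then for every $\mathbf u\in U$, $$P_{\mathcal M}(\mathbf u)=\pi\circ E^{-1}(\mathbf u)$$ is the unique solution of the minimization problem $\operatorname{argmin}_{\mathbf m\in\mathcal M}\|\mathbf u-\mathbf m\|_2$ (here $E^{-1}$ denotes the inverse of the bijection $E\colon V\to U$).
   Context: $\mathcal M\subset\mathbb R^d$ is a smooth compact Riemannian submanifold (with the metric induced from $\mathbb R^d$), $T_{\mathbf m}\mathcal M$ and $N_{\mathbf m}\mathcal M=(T_{\mathbf m}\mathcal M)^\perp$ are the tangent and normal spaces at $\mathbf m\in\mathcal M$. The normal bundle is $N\mathcal M=\{(\mathbf m,\mathbf v)\in\mathbb R^d\times\mathbb R^d:\mathbf m\in\mathcal M,\ \mathbf v\in N_{\mathbf m}\mathcal M\}$, and $E\colon N\mathcal M\to\mathbb R^d$ is $E(\mathbf m,\mathbf v)=\mathbf m+\mathbf v$. The reach $\tau>0$ of $\mathcal M$ is the maximal constant such that $E$ restricted to $V=\{(\mathbf m,\mathbf v)\in N\mathcal M:\|\mathbf v\|_2<\tau\}$ is injective; then $E\colon V\to U=E(V)$ is a diffeomorphism.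 $P_{\mathcal M}(\mathbf x)=\operatorname{argmin}_{\mathbf m\in\mathcal M}\|\mathbf x-\mathbf m\|_2$ is the (nearest point) projection operator onto $\mathcal M$. *)

theory Defs
  imports "HOL-Analysis.Analysis"
begin

text \<open>
  Smoothness is meant for open \<open>S\<close> only: the derivatives are two-sided, and \<open>k\<close>-fold
  differentiability is phrased through directional derivatives, so that the iterated
  derivatives all have the same type.
\<close>

primrec Ck_on :: "nat \<Rightarrow> 'a::euclidean_space set \<Rightarrow> ('a \<Rightarrow> 'b::euclidean_space) \<Rightarrow> bool" where
  "Ck_on 0 S f \<longleftrightarrow> continuous_on S f"
| "Ck_on (Suc k) S f \<longleftrightarrow>
     (\<forall>x\<in>S. f differentiable (at x)) \<and>
     (\<forall>v. Ck_on k S (\<lambda>x. frechet_derivative f (at x) v))"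

definition smooth_on :: "'a::euclidean_space set \<Rightarrow> ('a \<Rightarrow> 'b::euclidean_space) \<Rightarrow> bool" where
  "smooth_on S f \<longleftrightarrow> (\<forall>k. Ck_on k S f)"

text \<open>
  Embedded submanifolds without boundary, of constant dimension \<open>n\<close>, given by slice charts:
  locally a diffeomorphism between open sets of the ambient space straightens \<open>M\<close> to an
  \<open>n\<close>-dimensional linear subspace.
\<close>

definition smooth_submanifold :: "nat \<Rightarrow> 'a::euclidean_space set \<Rightarrow> bool" where
  "smooth_submanifold n M \<longleftrightarrow>
     (\<forall>p\<in>M. \<exists>W W' \<phi> \<psi> L.
        open W \<and> p \<in> W \<and> open W' \<and>
        homeomorphism W W' \<phi> \<psi> \<and> smooth_on W \<phi> \<and> smooth_on W' \<psi> \<and>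
        subspace (L :: 'a set) \<and> dim L = n \<and> \<phi> ` (W \<inter> M) = W' \<inter> L)"

text \<open>Tangent vectors are the velocities of smooth curves in \<open>M\<close>.\<close>

definition tangent_space :: "'a::euclidean_space set \<Rightarrow> 'a \<Rightarrow> 'a set" where
  "tangent_space M m =
     {v. \<exists>\<gamma> \<epsilon>. \<epsilon> > 0 \<and> smooth_on {-\<epsilon><..<\<epsilon>} \<gamma> \<and> \<gamma> ` {-\<epsilon><..<\<epsilon>} \<subseteq> M \<and>
        \<gamma> 0 = m \<and> (\<gamma> has_vector_derivative v) (at (0::real))}"

definition normal_space :: "'a::euclidean_space set \<Rightarrow> 'a \<Rightarrow> 'a set" where
  "normal_space M m = orthogonal_comp (tangent_space M m)"

definition normal_bundle :: "'a::euclidean_space set \<Rightarrow> ('a \<times> 'a) set" where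
  "normal_bundle M = {(m, v). m \<in> M \<and> v \<in> normal_space M m}"

definition endpoint_map :: "'a::euclidean_space \<times> 'a \<Rightarrow> 'a" where
  "endpoint_map = (\<lambda>(m, v). m + v)"

definition normal_disc_bundle :: "'a::euclidean_space set \<Rightarrow> ereal \<Rightarrow> ('a \<times> 'a) set" where
  "normal_disc_bundle M r = {(m, v) \<in> normal_bundle M. ereal (norm v) < r}"

text \<open>
  The reach is extended-real-valued because it is infinite for a single point.
  The supremum is attained, see \<open>reach_is_greatest\<close> below.
\<close>

definition reach :: "'a::euclidean_space set \<Rightarrow> ereal" where
  "reach M = Sup {r. inj_on endpoint_map (normal_disc_bundle M r)}"

definition tubular_domain :: "'a::euclidean_space set \<Rightarrow> ('a \<times> 'a) set" where
  "tubular_domain M = normal_disc_bundle M (reach M)"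

definition tubular_neighborhood :: "'a::euclidean_space set \<Rightarrow> 'a set" where
  "tubular_neighborhood M = endpoint_map ` tubular_domain M"

definition bundle_proj :: "'a::euclidean_space \<times> 'a \<Rightarrow> 'a" where
  "bundle_proj = (\<lambda>(m, v). m)"

definition nearest_point_proj :: "'a::euclidean_space set \<Rightarrow> 'a \<Rightarrow> 'a" where
  "nearest_point_proj M x = arg_min_on (\<lambda>m. norm (x - m)) M"

lemma inj_on_tubular_domain: "inj_on endpoint_map (tubular_domain M)"
proof (rule inj_onI)
  fix p q
  assume p: "p \<in> tubular_domain M" and q: "q \<in> tubular_domain M"
    and eq: "endpoint_map p = endpoint_map q"
  have "max (ereal (norm (snd p))) (ereal (norm (snd q))) < reach M"
    using p q by (auto simp: tubular_domain_def normal_disc_bundle_def)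
  then obtain r where r: "inj_on endpoint_map (normal_disc_bundle M r)"
    and less: "max (ereal (norm (snd p))) (ereal (norm (snd q))) < r"
    unfolding reach_def less_Sup_iff by blast
  have "p \<in> normal_disc_bundle M r" "q \<in> normal_disc_bundle M r"
    using p q less by (auto simp: tubular_domain_def normal_disc_bundle_def)
  with r eq show "p = q" by (auto dest: inj_onD)
qed

lemma reach_is_greatest:
  "inj_on endpoint_map (normal_disc_bundle M (reach M))"
  "inj_on endpoint_map (normal_disc_bundle M r) \<Longrightarrow> r \<le> reach M"
  using inj_on_tubular_domain by (auto simp: tubular_domain_def reach_def intro: Sup_upper)

lemma bij_betw_endpoint_map:
  "bij_betw endpoint_map (tubular_domain M) (tubular_neighborhood M)"
  by (simp add: bij_betw_def inj_on_tubular_domain tubular_neighborhood_def)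

end

theory Submission
  imports Defs
begin

text \<open>
  A point of \<open>M\<close> nearest to \<open>u = m + v\<close> sees \<open>u\<close> in a normal direction of length at most
  \<open>norm v\<close>, which is less than the reach. So it yields a second preimage of \<open>u\<close> in the domain
  on which the endpoint map is injective, and this preimage must be \<open>(m, v)\<close>.
\<close>

text \<open>First-order condition: along any curve in \<open>M\<close> through \<open>p\<close>, the
  distance to \<open>u\<close> is least at parameter 0, so differentiating there makes the velocity
  orthogonal to \<open>u - p\<close>.\<close>

lemma is_arg_min_imp_normal:
  fixes M :: "'a::euclidean_space set"
  assumes "is_arg_min (\<lambda>m. norm (u - m)) (\<lambda>m. m \<in> M) p"
  shows "u - p \<in> normal_space M p"
proof -
  have "v \<bullet> (u - p) = 0" if v: "v \<in> tangent_space M p" for v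
  proof -
    obtain \<gamma> \<epsilon> where e: "\<epsilon> > 0" and sub: "\<gamma> ` {-\<epsilon><..<\<epsilon>} \<subseteq> M" and g0: "\<gamma> 0 = p"
      and der: "(\<gamma> has_vector_derivative v) (at (0::real))"
      using v by (auto simp: tangent_space_def)
    \<comment> \<open>The squared distance is differentiable at 0 even if \<open>u = p\<close>,
      where the norm itself need not be.\<close>
    define g where "g t = (u - \<gamma> t) \<bullet> (u - \<gamma> t)" for t
    have "(g has_real_derivative - 2 * (v \<bullet> (u - p))) (at 0)"
      using der unfolding g_def has_vector_derivative_def has_field_derivative_def
      by (auto intro!: derivative_eq_intros simp: g0 inner_commute algebra_simps)
    moreover have "g 0 \<le> g t" if "\<bar>0 - t\<bar> < \<epsilon>" for t
    proof -
      have "\<gamma> t \<in> M" using sub that by (auto simp: abs_less_iff)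
      then have "norm (u - p) \<le> norm (u - \<gamma> t)"
        using assms by (auto simp: is_arg_min_linorder)
      then show ?thesis by (simp add: g_def g0 norm_le)
    qed
    ultimately have "- 2 * (v \<bullet> (u - p)) = 0"
      using e by (blast intro: DERIV_local_min)
    then show ?thesis by simp
  qed
  then show ?thesis by (simp add: normal_space_def orthogonal_comp_def orthogonal_def)
qed

lemma is_arg_min_dist_unique:
  assumes mv: "(m, v) \<in> tubular_domain M"
    and p: "is_arg_min (\<lambda>x. norm (m + v - x)) (\<lambda>x. x \<in> M) p"
  shows "p = m"
proof -
  have "m \<in> M" and v: "ereal (norm v) < reach M"
    using mv by (auto simp: tubular_domain_def normal_disc_bundle_def normal_bundle_def)
  \<comment> \<open>The base point \<open>m\<close> is itself a competitor, at distance
    \<open>norm v\<close> from \<open>m + v\<close>.\<close>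
  then have "norm (m + v - p) \<le> norm v"
    using p by (force simp: is_arg_min_linorder)
  then have "ereal (norm (m + v - p)) < reach M"
    using v by (meson ereal_less_eq(3) order_le_less_trans)
  then have "(p, m + v - p) \<in> tubular_domain M"
    using p is_arg_min_imp_normal[OF p]
    by (auto simp: tubular_domain_def normal_disc_bundle_def normal_bundle_def is_arg_min_def)
  moreover have "endpoint_map (p, m + v - p) = endpoint_map (m, v)"
    by (simp add: endpoint_map_def)
  ultimately show ?thesis
    using mv inj_on_tubular_domain[of M] by (auto dest: inj_onD)
qed

theorem lemma2p1:
  fixes M :: "(real ^ 'd) set" and n :: nat and u :: "real ^ 'd"
  assumes "smooth_submanifold n M" and "compact M"
    and "u \<in> tubular_neighborhood M"
  shows "nearest_point_proj M u = (bundle_proj \<circ> inv_into (tubular_domain M) endpoint_map) u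
    \<and> is_arg_min (\<lambda>m. norm (u - m)) (\<lambda>m. m \<in> M) (nearest_point_proj M u)
    \<and> (\<forall>m. is_arg_min (\<lambda>m. norm (u - m)) (\<lambda>m. m \<in> M) m \<longrightarrow> m = nearest_point_proj M u)"
proof -
  obtain m v where mv: "(m, v) \<in> tubular_domain M" and u: "u = m + v"
    using assms(3) by (auto simp: tubular_neighborhood_def endpoint_map_def)
  have "m \<in> M"
    using mv by (auto simp: tubular_domain_def normal_disc_bundle_def normal_bundle_def)
  \<comment> \<open>Existence comes from compactness; \<open>m\<close> shows that \<open>M\<close>
    is nonempty.\<close>
  then obtain p where "is_arg_min (\<lambda>m. norm (u - m)) (\<lambda>m. m \<in> M) p"
    using continuous_attains_inf[OF assms(2), of "\<lambda>m. norm (u - m)"]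
    by (force simp: is_arg_min_linorder intro: continuous_intros)
  \<comment> \<open>\<open>nearest_point_proj\<close> is a Hilbert choice, so it is known to be a
    minimizer only once some minimizer exists.\<close>
  then have min: "is_arg_min (\<lambda>m. norm (u - m)) (\<lambda>m. m \<in> M) (nearest_point_proj M u)"
    unfolding nearest_point_proj_def arg_min_on_def arg_min_def by (rule someI)
  have uniq: "x = m" if "is_arg_min (\<lambda>m. norm (u - m)) (\<lambda>m. m \<in> M) x" for x
    using is_arg_min_dist_unique[OF mv] that by (simp add: u)
  \<comment> \<open>Injectivity forces the preimage chosen by \<open>inv_into\<close> to be
    \<open>(m, v)\<close>, whose base point is \<open>m\<close>.\<close>
  have "inv_into (tubular_domain M) endpoint_map u = (m, v)"
    by (rule inv_into_f_eq[OF inj_on_tubular_domain mv]) (simp add: endpoint_map_def u)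
  then show ?thesis
    using min uniq by (auto simp: bundle_proj_def)
qed

end
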